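(* Any two Euclidean norms $\bar\alpha$ and $\alpha$ on $\mathbb{R}^n$ satisfy $\bar\alpha\overset{1}{\sim}\alpha$. Moreover, $\bar\alpha=T_{\vec b,\phi}(\alpha)$ for a single deformation with some $\vec b$ of length $n$ and some function $\phi$ of $n$ variables.
   Context: A Minkowski norm on $\mathbb{R}^n$ ($n>1$) is a function $F:\mathbb{R}^n\to[0,\infty)$ that is $C^\infty$ on $\mathbb{R}^n\setminus\{0\}$, satisfies $F(\lambda y)=\lambda F(y)$ for $\lambda>0$, and such that for every $y\ne 0$ the symmetric bilinear form $g_y(u,v)=\frac12\frac{\partial^2}{\partial s\,\partial t}[F^2(y+su+tv)]_{|s=t=0}$ is positive definite. A Euclidean norm is the norm of an inner product; it is a Minkowski norm. 1-forms on $\mathbb{R}^n$ are linear functionals. For a Minkowski norm $F$, a 1-form $\beta$ has norm $F(\beta)=\sup_{y\neq 0}|\beta(y)|/F(y)$. Given linearly independent 1-forms $\vec b=(\beta_1,\dots,\beta_q)$, $q\le n$ (the length of $\vec b$ is $q$), and a smooth function $\phi:\prod_{i=1}^q[-\delta_i,\delta_i]\to(0,\infty)$ with $F(\beta_i)<\delta_i$, the $T_{\vec b,\phi}$-deformation of $F$ is $T_{\vec b,\phi}(F)=F\cdot\phi(\beta_1/F,\dots,\beta_q/F)$. Standing assumption on deformations: $\phi-\sum_i s_i\,\partial\phi/\partial s_i>0$. For Minkowski norms $F,\bar F$ on $\mathbb{R}^n$ and $p\le n$, write $\bar F\overset{p}{\sim}F$ if there are finitely many deformations $T_{\vec b^i,\phi_i}$,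 $1\le i\le m$, with each $\vec b^i$ of length $\le p$, and Minkowski norms $F_0=F,F_1,\dots,F_m=\bar F$ such that $F_i=T_{\vec b^i,\phi_i}(F_{i-1})$ for $1\le i\le m$. *)

theory Defs
  imports "HOL-Analysis.Analysis"
begin

(* Only meant for open sets: derivatives are taken at interior points. *)
primrec Ck_on :: "nat \<Rightarrow> 'a::real_normed_vector set \<Rightarrow> ('a \<Rightarrow> real) \<Rightarrow> bool" where
  "Ck_on 0 = (\<lambda>U f. continuous_on U f)"
| "Ck_on (Suc k) = (\<lambda>U f. (\<forall>x\<in>U. f differentiable (at x)) \<and>
     (\<forall>v. Ck_on k U (\<lambda>x. frechet_derivative f (at x) v)))"

(* Smoothness on an arbitrary set, such as a closed box: the function is the restriction of
   a smooth function on an open neighbourhood. For open S this is smoothness on S itself. *)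
definition smooth_on :: "'a::real_normed_vector set \<Rightarrow> ('a \<Rightarrow> real) \<Rightarrow> bool" where
  "smooth_on S f \<longleftrightarrow>
     (\<exists>U g. open U \<and> S \<subseteq> U \<and> (\<forall>k. Ck_on k U g) \<and> (\<forall>x\<in>S. g x = f x))"

definition fundamental_form ::
  "(real ^ 'n \<Rightarrow> real) \<Rightarrow> real ^ 'n \<Rightarrow> real ^ 'n \<Rightarrow> real ^ 'n \<Rightarrow> real" where
  "fundamental_form F y u v =
     1/2 * deriv (\<lambda>s. deriv (\<lambda>t. (F (y + s *\<^sub>R u + t *\<^sub>R v))\<^sup>2) 0) 0"

(* The form is bilinear and symmetric by smoothness of F, so only definiteness is a condition.
   Homogeneity at y = 0 forces F 0 = 0. *)
definition minkowski_norm :: "(real ^ 'n \<Rightarrow> real) \<Rightarrow> bool" where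
  "minkowski_norm F \<longleftrightarrow>
     (\<forall>y. 0 \<le> F y) \<and>
     smooth_on (- {0}) F \<and>
     (\<forall>c y. 0 < c \<longrightarrow> F (c *\<^sub>R y) = c * F y) \<and>
     (\<forall>y u. y \<noteq> 0 \<longrightarrow> u \<noteq> 0 \<longrightarrow> 0 < fundamental_form F y u u)"

definition inner_product_on_Rn :: "(real ^ 'n \<Rightarrow> real ^ 'n \<Rightarrow> real) \<Rightarrow> bool" where
  "inner_product_on_Rn B \<longleftrightarrow>
     bilinear B \<and> (\<forall>u v. B u v = B v u) \<and> (\<forall>u. u \<noteq> 0 \<longrightarrow> 0 < B u u)"

definition euclidean_norm :: "(real ^ 'n \<Rightarrow> real) \<Rightarrow> bool" where
  "euclidean_norm \<alpha> \<longleftrightarrow> (\<exists>B. inner_product_on_Rn B \<and> (\<forall>y. \<alpha> y = sqrt (B y y)))"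

(* On the finite-dimensional space R^n every linear functional is bounded. *)
type_synonym 'n one_form = "(real ^ 'n) \<Rightarrow>\<^sub>L real"

definition form_norm :: "(real ^ 'n \<Rightarrow> real) \<Rightarrow> 'n one_form \<Rightarrow> real" where
  "form_norm F \<beta> = (SUP y\<in>- {0}. \<bar>blinfun_apply \<beta> y\<bar> / F y)"

(* A tuple of q \<le> n one-forms is indexed by a set I \<subseteq> {coordinates of R^n} with card I = q,
   and R^q is identified with the vectors in R^n vanishing at the coordinates outside I.
   This lets q range over 1..n inside a formula; everything below depends only on the
   values of b and \<delta> at indices in I and on the values of \<phi> on this subspace. *)

definition form_box :: "'n set \<Rightarrow> ('n \<Rightarrow> real) \<Rightarrow> (real ^ 'n) set" where
  "form_box I \<delta> = {s. (\<forall>i\<in>I. \<bar>s $ i\<bar> \<le> \<delta> i) \<and> (\<forall>i. i \<notin> I \<longrightarrow> s $ i = 0)}"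

(* One-sided on the faces of the box. *)
definition box_partial ::
  "('n \<Rightarrow> real) \<Rightarrow> 'n \<Rightarrow> (real ^ 'n \<Rightarrow> real) \<Rightarrow> real ^ 'n \<Rightarrow> real" where
  "box_partial \<delta> i \<phi> s =
     vector_derivative (\<lambda>t. \<phi> (\<chi> j. if j = i then t else s $ j)) (at (s $ i) within {- \<delta> i..\<delta> i})"

(* At y = 0 both sides vanish for a Minkowski norm, since F 0 = 0. *)
definition deformation ::
  "'n set \<Rightarrow> ('n \<Rightarrow> 'n one_form) \<Rightarrow> (real ^ 'n \<Rightarrow> real) \<Rightarrow> (real ^ 'n \<Rightarrow> real) \<Rightarrow> real ^ 'n \<Rightarrow> real"
where
  "deformation I b \<phi> F =
     (\<lambda>y. F y * \<phi> (\<chi> i. if i \<in> I then blinfun_apply (b i) y / F y else 0))"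

definition admissible_deformation ::
  "'n set \<Rightarrow> ('n \<Rightarrow> 'n one_form) \<Rightarrow> ('n \<Rightarrow> real) \<Rightarrow> (real ^ 'n \<Rightarrow> real) \<Rightarrow> (real ^ 'n \<Rightarrow> real) \<Rightarrow> bool"
where
  "admissible_deformation I b \<delta> \<phi> F \<longleftrightarrow>
     I \<noteq> {} \<and>
     inj_on b I \<and> independent (b ` I) \<and>
     (\<forall>i\<in>I. form_norm F (b i) < \<delta> i) \<and>
     smooth_on (form_box I \<delta>) \<phi> \<and>
     (\<forall>s\<in>form_box I \<delta>. 0 < \<phi> s) \<and>
     (\<forall>s\<in>form_box I \<delta>. 0 < \<phi> s - (\<Sum>i\<in>I. s $ i * box_partial \<delta> i \<phi> s))"

definition deformation_related ::
  "nat \<Rightarrow> (real ^ 'n \<Rightarrow> real) \<Rightarrow> (real ^ 'n \<Rightarrow> real) \<Rightarrow> bool" where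
  "deformation_related p F' F \<longleftrightarrow>
     (\<exists>(m::nat) G. G 0 = F \<and> G m = F' \<and> (\<forall>i\<le>m. minkowski_norm (G i)) \<and>
        (\<forall>i\<in>{1..m}. \<exists>I b \<delta> \<phi>. card I \<le> p \<and>
           admissible_deformation I b \<delta> \<phi> (G (i - 1)) \<and>
           G i = deformation I b \<phi> (G (i - 1))))"

end

theory Submission
  imports Defs
begin

text \<open>
  Let \<open>A\<close> and \<open>B\<close> be the inner products behind \<open>\<alpha>\<close> and \<open>\<alpha>'\<close>.  Everything rests on one family
  of deformation functions, \<open>\<phi> s = sqrt (c + Q s s)\<close> with \<open>c > 0\<close> and \<open>Q\<close> a positive semidefinite
  form.  Because \<open>Q\<close> is homogeneous of degree two, Euler's identity gives
  \<open>\<phi> - (\<Sum>i. s\<^sub>i \<partial>\<^sub>i\<phi>) = c / \<phi>\<close>, which is positive; so \<open>\<phi>\<close> is admissible on every box and for every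
  choice of linearly independent forms \<open>\<beta>\<^sub>i\<close> (lemma \<open>admissible_sqrt_quadratic\<close>), and it turns
  \<open>A y y\<close> into \<open>c * A y y + Q (\<beta> y) (\<beta> y)\<close> (lemma \<open>euclidean_deformation\<close>).

  By compactness of the unit sphere there is \<open>c > 0\<close> with \<open>c * A y y \<le> B y y\<close>, that is, \<open>B - c * A\<close>
  is positive semidefinite.  Taking the coordinates for the \<open>\<beta>\<^sub>i\<close> and \<open>Q = B - c * A\<close> gives \<open>B\<close> in a
  single deformation by \<open>n\<close> forms.

  For deformations by one form at a time, first replace \<open>A\<close> by \<open>c * A\<close> (the constant
  \<open>\<phi> = sqrt c\<close>), and then add the squares of linear forms into which the positive semidefinite form
  \<open>B - c * A\<close> decomposes.  The squares are split off one coordinate at a time, as in the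
  Cholesky decomposition, and each partial sum is again an inner product
  (lemma \<open>deformation_related_add_psd_form\<close>).
\<close>

section \<open>Smoothness of products of polynomials and real powers\<close>

lemma Ck_on_cong:
  assumes "open U" "\<And>x. x \<in> U \<Longrightarrow> f x = g x"
  shows "Ck_on k U f \<longleftrightarrow> Ck_on k U g"
  using assms(2)
proof (induction k arbitrary: f g)
  case 0
  then show ?case by (auto cong: continuous_on_cong)
next
  case (Suc k)
  have diff: "f differentiable at x \<longleftrightarrow> g differentiable at x" if "x \<in> U" for x
    using that Suc.prems \<open>open U\<close> unfolding differentiable_def
    by (metis has_derivative_transform_within_open)
  have deriv: "frechet_derivative f (at x) = frechet_derivative g (at x)"
    if "x \<in> U" "f differentiable at x" for x
    using frechet_derivative_transform_within_open[OF that(2) \<open>open U\<close> that(1)] Suc.prems by blast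
  have IH: "Ck_on k U (\<lambda>x. frechet_derivative f (at x) v) \<longleftrightarrow>
        Ck_on k U (\<lambda>x. frechet_derivative g (at x) v)"
    if "\<forall>x\<in>U. f differentiable at x" for v
    by (rule Suc.IH) (use deriv that in auto)
  show ?case using diff IH by auto
qed

text \<open>Among properties implying differentiability, smoothness is the weakest that is inherited by
  all directional derivatives.  It therefore suffices to exhibit a family \<open>X\<close> of differentiable
  functions that is closed under directional derivatives up to their values outside \<open>U\<close>.\<close>
lemma Ck_on_coinduct:
  assumes "open U" "f \<in> X"
    and step: "\<And>f. f \<in> X \<Longrightarrow> \<exists>f'. (\<forall>v. f' v \<in> X) \<and> (\<forall>x\<in>U. (f has_derivative (\<lambda>v. f' v x)) (at x))"
  shows "Ck_on k U f"
  using assms(2)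
proof (induction k arbitrary: f)
  case 0
  then obtain f' where "\<forall>x\<in>U. (f has_derivative (\<lambda>v. f' v x)) (at x)"
    using step by blast
  then show ?case
    by (auto intro!: continuous_at_imp_continuous_on has_derivative_continuous)
next
  case (Suc k)
  then obtain f' where f': "\<And>v. f' v \<in> X" "\<And>x. x \<in> U \<Longrightarrow> (f has_derivative (\<lambda>v. f' v x)) (at x)"
    using step by blast
  have "Ck_on k U (\<lambda>x. frechet_derivative f (at x) v)" for v
  proof (subst Ck_on_cong[OF \<open>open U\<close>])
    show "frechet_derivative f (at x) v = f' v x" if "x \<in> U" for x
      using frechet_derivative_at[OF f'(2)[OF that]] by metis
    show "Ck_on k U (f' v)" by (rule Suc.IH) (rule f')
  qed
  then show ?case using f'(2) by (auto simp: differentiable_def)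
qed

lemma real_polynomial_function_has_derivative:
  assumes "real_polynomial_function p"
  shows "\<exists>p'. (\<forall>v. real_polynomial_function (p' v)) \<and> (\<forall>x. (p has_derivative (\<lambda>v. p' v x)) (at x))"
  using assms
proof (induction rule: real_polynomial_function.induct)
  case (linear f)
  then have "\<forall>x. (f has_derivative (\<lambda>v. f v)) (at x)"
    by (auto intro: bounded_linear_imp_has_derivative)
  then show ?case
    by (intro exI[of _ "\<lambda>v _. f v"]) auto
next
  case (const c)
  show ?case
    by (intro exI[of _ "\<lambda>v _. 0"]) auto
next
  case (add f g)
  then obtain f' g' where
    "\<And>v. real_polynomial_function (f' v)" "\<And>x. (f has_derivative (\<lambda>v. f' v x)) (at x)"
    "\<And>v. real_polynomial_function (g' v)" "\<And>x. (g has_derivative (\<lambda>v. g' v x)) (at x)"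
    by blast
  then show ?case
    by (intro exI[of _ "\<lambda>v x. f' v x + g' v x"]) (auto intro!: derivative_eq_intros)
next
  case (mult f g)
  then obtain f' g' where
    "\<And>v. real_polynomial_function (f' v)" "\<And>x. (f has_derivative (\<lambda>v. f' v x)) (at x)"
    "\<And>v. real_polynomial_function (g' v)" "\<And>x. (g has_derivative (\<lambda>v. g' v x)) (at x)"
    by blast
  with mult.hyps show ?case
    by (intro exI[of _ "\<lambda>v x. f x * g' v x + f' v x * g x"])
       (auto intro!: derivative_eq_intros real_polynomial_function.intros(3,4))
qed

text \<open>For fixed \<open>q\<close>, the functions \<open>p * q powr r\<close> with \<open>p\<close> a polynomial form a family closed under
  directional derivatives: the derivative is \<open>(p' * q + r * p * q') * q powr (r - 1)\<close>.\<close>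
lemma Ck_on_polynomial_mult_powr:
  fixes p q :: "'a::real_normed_vector \<Rightarrow> real"
  assumes "open U" "real_polynomial_function p" "real_polynomial_function q" "\<And>x. x \<in> U \<Longrightarrow> 0 < q x"
  shows "Ck_on k U (\<lambda>x. p x * q x powr r)"
proof (rule Ck_on_coinduct[OF \<open>open U\<close>])
  let ?X = "{\<lambda>x. p x * q x powr r | p r. real_polynomial_function p}"
  show "(\<lambda>x. p x * q x powr r) \<in> ?X" using assms(2) by blast
  fix f assume "f \<in> ?X"
  then obtain p r where p: "real_polynomial_function p" and f: "f = (\<lambda>x. p x * q x powr r)"
    by blast
  obtain p' where p': "\<And>v. real_polynomial_function (p' v)" "\<And>x. (p has_derivative (\<lambda>v. p' v x)) (at x)"
    using real_polynomial_function_has_derivative[OF p] by blast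
  obtain q' where q': "\<And>v. real_polynomial_function (q' v)" "\<And>x. (q has_derivative (\<lambda>v. q' v x)) (at x)"
    using real_polynomial_function_has_derivative[OF assms(3)] by blast
  let ?f' = "\<lambda>v x. (p' v x * q x + r * (p x * q' v x)) * q x powr (r - 1)"
  have "?f' v \<in> ?X" for v
    by (intro CollectI exI[of _ "\<lambda>x. p' v x * q x + r * (p x * q' v x)"] exI[of _ "r - 1"]
        conjI refl real_polynomial_function.intros(2-4) p p' q' assms(3))
  moreover have "(f has_derivative (\<lambda>v. ?f' v x)) (at x)" if "x \<in> U" for x
  proof -
    have q: "0 < q x" using assms(4) that .
    \<comment> \<open>The product rule produces both \<open>q powr r\<close> and \<open>q powr (r - 1)\<close>; bring them to one exponent.\<close>
    have "q x powr r = q x * q x powr (r - 1)"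
      using q by (simp add: powr_diff)
    then show ?thesis
      unfolding f using q
      by (auto intro!: derivative_eq_intros p' q' simp: field_simps)
  qed
  ultimately show "\<exists>f'. (\<forall>v. f' v \<in> ?X) \<and> (\<forall>x\<in>U. (f has_derivative (\<lambda>v. f' v x)) (at x))"
    by (intro exI[of _ ?f']) auto
qed

lemma smooth_on_sqrt_polynomial:
  fixes q :: "'a::real_normed_vector \<Rightarrow> real"
  assumes "open U" "S \<subseteq> U" "real_polynomial_function q" "\<And>x. x \<in> U \<Longrightarrow> 0 < q x"
  shows "smooth_on S (\<lambda>x. sqrt (q x))"
  unfolding smooth_on_def
proof (intro exI conjI allI ballI)
  show "Ck_on k U (\<lambda>x. 1 * q x powr (1/2))" for k
    using assms by (intro Ck_on_polynomial_mult_powr) auto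
  show "1 * q x powr (1/2) = sqrt (q x)" if "x \<in> S" for x
    using assms(4)[of x] assms(2) that by (simp add: powr_half_sqrt less_imp_le subset_iff)
qed (use assms in auto)

section \<open>Positive semidefinite forms and Euclidean norms\<close>

definition psd_form :: "(real ^ 'n \<Rightarrow> real ^ 'n \<Rightarrow> real) \<Rightarrow> bool" where
  "psd_form Q \<longleftrightarrow> bilinear Q \<and> (\<forall>u v. Q u v = Q v u) \<and> (\<forall>u. 0 \<le> Q u u)"

lemma inner_product_on_Rn_imp_psd_form: "inner_product_on_Rn A \<Longrightarrow> psd_form A"
  unfolding inner_product_on_Rn_def psd_form_def
  by (metis bilinear_lzero less_eq_real_def)

lemma bilinear_expand_left:
  fixes Q :: "real ^ 'n \<Rightarrow> real ^ 'n \<Rightarrow> real"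
  assumes "bilinear Q"
  shows "Q x y = (\<Sum>i\<in>UNIV. x $ i * Q (axis i 1) y)"
proof -
  have lin: "linear (\<lambda>x. Q x y)" using assms by (simp add: bilinear_def)
  have "Q x y = Q (\<Sum>i\<in>UNIV. x $ i *\<^sub>R axis i 1) y"
    by (simp add: basis_expansion flip: scalar_mult_eq_scaleR)
  also have "\<dots> = (\<Sum>i\<in>UNIV. x $ i * Q (axis i 1) y)"
    by (simp add: linear_sum[OF lin] linear_cmul[OF lin])
  finally show ?thesis .
qed

lemma real_polynomial_function_bilinear:
  fixes Q :: "real ^ 'n \<Rightarrow> real ^ 'n \<Rightarrow> real"
  assumes "bilinear Q"
  shows "real_polynomial_function (\<lambda>x. Q x x)"
proof -
  have "bounded_linear (Q u)" for u
    using assms by (simp add: bilinear_def linear_conv_bounded_linear)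
  then show ?thesis
    by (subst bilinear_expand_left[OF assms])
       (auto intro!: real_polynomial_function_sum real_polynomial_function.intros(4)
         intro: real_polynomial_function.intros(1) simp: bounded_linear_vec_nth)
qed

lemma has_real_derivative_quadratic_line:
  assumes "bilinear Q" "\<And>u v. Q u v = Q v u"
  shows "((\<lambda>t. Q (y + t *\<^sub>R v) (y + t *\<^sub>R v)) has_real_derivative 2 * Q (y + t *\<^sub>R v) v) (at t)"
proof -
  have "(\<lambda>t. Q (y + t *\<^sub>R v) (y + t *\<^sub>R v)) = (\<lambda>t. Q y y + 2 * t * Q y v + t\<^sup>2 * Q v v)"
    using assms(2)[of v y]
    by (auto simp: bilinear_ladd[OF assms(1)] bilinear_radd[OF assms(1)]
        bilinear_lmul[OF assms(1)] bilinear_rmul[OF assms(1)] algebra_simps power2_eq_square)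
  then show ?thesis
    by (auto intro!: derivative_eq_intros
        simp: bilinear_ladd[OF assms(1)] bilinear_lmul[OF assms(1)])
qed

lemma fundamental_form_inner_product:
  assumes "inner_product_on_Rn A"
  shows "fundamental_form (\<lambda>y. sqrt (A y y)) y u v = A u v"
proof -
  have A: "bilinear A" "\<And>u v. A u v = A v u" "\<And>u. 0 \<le> A u u"
    using inner_product_on_Rn_imp_psd_form[OF assms] by (auto simp: psd_form_def)
  have "deriv (\<lambda>t. A (y + s *\<^sub>R u + t *\<^sub>R v) (y + s *\<^sub>R u + t *\<^sub>R v)) 0 = 2 * A (y + s *\<^sub>R u) v" for s
    using has_real_derivative_quadratic_line[OF A(1,2), of "y + s *\<^sub>R u" v 0]
    by (simp add: DERIV_imp_deriv)
  moreover have "((\<lambda>s. 2 * A (y + s *\<^sub>R u) v) has_real_derivative 2 * A u v) (at 0)"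
    by (auto intro!: derivative_eq_intros simp: bilinear_ladd[OF A(1)] bilinear_lmul[OF A(1)])
  ultimately show ?thesis
    using A(3) by (simp add: fundamental_form_def DERIV_imp_deriv)
qed

lemma minkowski_norm_inner_product:
  fixes A :: "real ^ 'n \<Rightarrow> real ^ 'n \<Rightarrow> real"
  assumes "inner_product_on_Rn A"
  shows "minkowski_norm (\<lambda>y. sqrt (A y y))"
  unfolding minkowski_norm_def
proof (intro conjI allI impI)
  have A: "bilinear A" "\<And>u. 0 \<le> A u u"
    using inner_product_on_Rn_imp_psd_form[OF assms] by (auto simp: psd_form_def)
  have pos: "\<And>u. u \<noteq> 0 \<Longrightarrow> 0 < A u u"
    using assms by (simp add: inner_product_on_Rn_def)
  show "0 \<le> sqrt (A y y)" for y using A(2) by simp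
  show "smooth_on (- {0}) (\<lambda>y. sqrt (A y y))"
    using pos by (intro smooth_on_sqrt_polynomial[of "- {0}"] real_polynomial_function_bilinear A) auto
  show "sqrt (A (c *\<^sub>R y) (c *\<^sub>R y)) = c * sqrt (A y y)" if "0 < c" for c y
    using that by (simp add: bilinear_lmul[OF A(1)] bilinear_rmul[OF A(1)] real_sqrt_mult)
  show "0 < fundamental_form (\<lambda>y. sqrt (A y y)) y u u" if "u \<noteq> 0" for y u
    using pos that by (simp add: fundamental_form_inner_product[OF assms])
qed

text \<open>The quotient \<open>B y y / A y y\<close> depends only on the direction of \<open>y\<close>, so it attains a positive
  minimum over the compact unit sphere.\<close>
lemma inner_product_dominates_multiple:
  fixes A B :: "real ^ 'n \<Rightarrow> real ^ 'n \<Rightarrow> real"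
  assumes A: "inner_product_on_Rn A" and B: "inner_product_on_Rn B"
  obtains c where "0 < c" "\<And>y. c * A y y \<le> B y y"
proof -
  have bil: "bilinear A" "bilinear B" and pos: "\<And>u. u \<noteq> 0 \<Longrightarrow> 0 < A u u" "\<And>u. u \<noteq> 0 \<Longrightarrow> 0 < B u u"
    using A B by (auto simp: inner_product_on_Rn_def)
  define S where "S = sphere (0 :: real ^ 'n) 1"
  have quad: "continuous_on S (\<lambda>y. Q y y)" if "bilinear Q" for Q :: "real ^ 'n \<Rightarrow> real ^ 'n \<Rightarrow> real"
    using bilinear_continuous_on_compose[OF continuous_on_id continuous_on_id that] by simp
  have cont: "continuous_on S (\<lambda>y. B y y / A y y)"
  proof (rule continuous_on_divide[OF _ _ ballI])
    fix y assume "y \<in> S"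
    then have "y \<noteq> 0" by (auto simp: S_def)
    from pos(1)[OF this] show "A y y \<noteq> 0" by simp
  qed (rule quad, rule bil)+
  have "S \<noteq> {}" "compact S" by (auto simp: S_def)
  then obtain x where x: "x \<in> S" "\<And>y. y \<in> S \<Longrightarrow> B x x / A x x \<le> B y y / A y y"
    using continuous_attains_inf[OF _ _ cont] by blast
  have "x \<noteq> 0" using x(1) by (auto simp: S_def)
  show ?thesis
  proof (rule that)
    show "0 < B x x / A x x" using pos \<open>x \<noteq> 0\<close> by simp
    show "B x x / A x x * A y y \<le> B y y" for y
    proof (cases "y = 0")
      case True
      then show ?thesis by (simp add: bilinear_lzero bil)
    next
      case False
      let ?z = "inverse (norm y) *\<^sub>R y"
      have "B ?z ?z / A ?z ?z = B y y / A y y"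
        using False by (simp add: bilinear_lmul bilinear_rmul bil)
      moreover have "?z \<in> S" using False by (simp add: S_def)
      ultimately have "B x x / A x x \<le> B y y / A y y" using x(2) by metis
      then show ?thesis using pos(1)[OF False] by (simp add: pos_le_divide_eq)
    qed
  qed
qed

lemma psd_form_Cauchy_Schwarz:
  assumes "psd_form Q"
  shows "(Q x y)\<^sup>2 \<le> Q x x * Q y y"
proof -
  have Q: "bilinear Q" "\<And>u v. Q u v = Q v u" "\<And>u. 0 \<le> Q u u"
    using assms by (auto simp: psd_form_def)
  have expand: "0 \<le> Q x x + 2 * t * Q x y + t\<^sup>2 * Q y y" for t
    using Q(3)[of "x + t *\<^sub>R y"] Q(2)[of y x]
    by (simp add: bilinear_ladd[OF Q(1)] bilinear_radd[OF Q(1)]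
        bilinear_lmul[OF Q(1)] bilinear_rmul[OF Q(1)] algebra_simps power2_eq_square)
  show ?thesis
  proof (cases "Q y y = 0")
    case True
    \<comment> \<open>The expansion is affine in \<open>t\<close>; a nonzero slope would let it reach the value \<open>- 1\<close>.\<close>
    have "Q x y = 0"
    proof (rule ccontr)
      assume "Q x y \<noteq> 0"
      then show False
        using expand[of "- (Q x x + 1) / (2 * Q x y)"] True by (simp add: field_simps)
    qed
    then show ?thesis using True by simp
  next
    case False
    then have "0 < Q y y" using Q(3)[of y] by simp
    \<comment> \<open>Evaluate at the minimiser of the expansion in \<open>t\<close>.\<close>
    moreover have "0 \<le> Q x x - (Q x y)\<^sup>2 / Q y y"
      using expand[of "- Q x y / Q y y"] False
      by (simp add: field_simps power2_eq_square)
    ultimately show ?thesis by (simp add: field_simps)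
  qed
qed

lemma psd_form_square:
  assumes "linear f"
  shows "psd_form (\<lambda>x y. f x * f y)"
  using assms unfolding psd_form_def bilinear_def
  by (auto simp: linear_iff algebra_simps)

lemma inner_product_add_psd_form:
  assumes "inner_product_on_Rn A" "psd_form Q" "0 < c"
  shows "inner_product_on_Rn (\<lambda>x y. c * A x y + Q x y)"
proof -
  have "bilinear (\<lambda>x y. c * A x y + Q x y)"
    using assms unfolding inner_product_on_Rn_def psd_form_def bilinear_def
    by (auto simp: linear_iff algebra_simps)
  then show ?thesis
    using assms by (simp add: inner_product_on_Rn_def psd_form_def add_pos_nonneg)
qed

section \<open>Deformations of Euclidean norms by quadratic functions\<close>

text \<open>The derivative of \<open>\<phi>\<close> along the \<open>i\<close>-th coordinate is \<open>Q s e\<^sub>i / \<phi>\<close>.  Since \<open>s\<close> vanishes outside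
  \<open>I\<close>, these sum up to \<open>Q s s / \<phi>\<close>, and \<open>\<phi> - Q s s / \<phi> = c / \<phi>\<close>.\<close>
lemma sqrt_quadratic_minus_radial_derivative:
  fixes Q :: "real ^ 'n \<Rightarrow> real ^ 'n \<Rightarrow> real"
  assumes Q: "psd_form Q" and "0 < c" and \<delta>: "\<And>i. i \<in> I \<Longrightarrow> 0 < \<delta> i" and s: "s \<in> form_box I \<delta>"
  shows "sqrt (c + Q s s) - (\<Sum>i\<in>I. s $ i * box_partial \<delta> i (\<lambda>s. sqrt (c + Q s s)) s)
       = c / sqrt (c + Q s s)"
proof -
  have bil: "bilinear Q" and sym: "\<And>u v. Q u v = Q v u" and nn: "\<And>u. 0 \<le> Q u u"
    using Q by (auto simp: psd_form_def)
  have pos: "0 < c + Q s s" using nn[of s] \<open>0 < c\<close> by simp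
  have partial: "box_partial \<delta> i (\<lambda>s. sqrt (c + Q s s)) s = Q (axis i 1) s / sqrt (c + Q s s)"
    if "i \<in> I" for i
  proof -
    \<comment> \<open>The point \<open>y\<close> is \<open>s\<close> with its \<open>i\<close>-th coordinate set to 0.  The function is differentiable on
      the whole line through \<open>s\<close>, so its two-sided derivative also gives the one-sided derivatives
      on the faces of the box.\<close>
    define y where "y = s - s $ i *\<^sub>R axis i 1"
    have line: "(\<chi> j. if j = i then t else s $ j) = y + t *\<^sub>R axis i 1" for t
      by (simp add: vec_eq_iff y_def axis_def)
    have s_eq: "y + s $ i *\<^sub>R axis i 1 = s" by (simp add: y_def)
    have "((\<lambda>t. sqrt (c + Q (y + t *\<^sub>R axis i 1) (y + t *\<^sub>R axis i 1)))
        has_real_derivative Q (axis i 1) s / sqrt (c + Q s s)) (at (s $ i))"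
    proof -
      have "((\<lambda>t. c + Q (y + t *\<^sub>R axis i 1) (y + t *\<^sub>R axis i 1))
          has_real_derivative 2 * Q s (axis i 1)) (at (s $ i))"
        using DERIV_add[OF DERIV_const[of c]
            has_real_derivative_quadratic_line[OF bil sym, of y "axis i 1" "s $ i"]]
        by (simp only: s_eq add_0)
      then have "((\<lambda>t. sqrt (c + Q (y + t *\<^sub>R axis i 1) (y + t *\<^sub>R axis i 1)))
          has_real_derivative inverse (sqrt (c + Q s s)) / 2 * (2 * Q s (axis i 1))) (at (s $ i))"
        by (rule DERIV_chain2[rotated]) (simp only: s_eq, rule DERIV_real_sqrt[OF pos])
      also have "inverse (sqrt (c + Q s s)) / 2 * (2 * Q s (axis i 1)) = Q (axis i 1) s / sqrt (c + Q s s)"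
        using pos sym[of s "axis i 1"] by (simp add: field_simps)
      finally show ?thesis .
    qed
    moreover have "- \<delta> i \<le> s $ i" "s $ i \<le> \<delta> i"
      using s that by (auto simp: form_box_def abs_le_iff)
    ultimately show ?thesis
      unfolding box_partial_def line
      using \<delta>[OF that] by (intro vector_derivative_at_within_ivl)
        (auto simp: has_real_derivative_iff_has_vector_derivative)
  qed
  have "(\<Sum>i\<in>I. s $ i * box_partial \<delta> i (\<lambda>s. sqrt (c + Q s s)) s)
      = (\<Sum>i\<in>I. s $ i * Q (axis i 1) s) / sqrt (c + Q s s)"
    by (simp add: partial sum_divide_distrib)
  also have "(\<Sum>i\<in>I. s $ i * Q (axis i 1) s) = (\<Sum>i\<in>UNIV. s $ i * Q (axis i 1) s)"
    using s by (intro sum.mono_neutral_left) (auto simp: form_box_def)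
  also have "\<dots> = Q s s" by (rule bilinear_expand_left[OF bil, symmetric])
  finally show ?thesis
    using pos by (simp add: field_simps)
qed

text \<open>As \<open>\<phi>\<close> is smooth and positive on the whole space, the box is only required to exceed the norms of
  the forms.  The absolute value ensures that its sides have positive length, so that the partial
  derivatives are taken over nondegenerate intervals.\<close>
lemma admissible_sqrt_quadratic:
  fixes Q :: "real ^ 'n \<Rightarrow> real ^ 'n \<Rightarrow> real"
  assumes "psd_form Q" "0 < c" "I \<noteq> {}" "inj_on b I" "independent (b ` I)"
  shows "admissible_deformation I b (\<lambda>i. \<bar>form_norm F (b i)\<bar> + 1) (\<lambda>s. sqrt (c + Q s s)) F"
proof -
  have bil: "bilinear Q" and pos: "\<And>s. 0 < c + Q s s"
    using assms by (auto simp: psd_form_def add_pos_nonneg)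
  let ?\<delta> = "\<lambda>i. \<bar>form_norm F (b i)\<bar> + 1"
  have "smooth_on (form_box I ?\<delta>) (\<lambda>s. sqrt (c + Q s s))"
    using pos bil by (intro smooth_on_sqrt_polynomial[of UNIV] real_polynomial_function.intros(2,3) real_polynomial_function_bilinear) auto
  moreover have "0 < sqrt (c + Q s s) -
      (\<Sum>i\<in>I. s $ i * box_partial ?\<delta> i (\<lambda>s. sqrt (c + Q s s)) s)" if "s \<in> form_box I ?\<delta>" for s
    using pos \<open>0 < c\<close>
    by (subst sqrt_quadratic_minus_radial_derivative[OF assms(1,2) _ that]) auto
  moreover have "form_norm F (b i) < ?\<delta> i" for i
    by linarith
  ultimately show ?thesis
    using assms pos by (simp add: admissible_deformation_def)
qed

text \<open>Since \<open>Q\<close> is homogeneous of degree two, multiplying \<open>c + Q (\<beta> y / a) (\<beta> y / a)\<close> by \<open>a\<^sup>2 = A y y\<close>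
  clears all denominators.\<close>
lemma euclidean_deformation:
  fixes A Q :: "real ^ 'n \<Rightarrow> real ^ 'n \<Rightarrow> real" and b :: "'n \<Rightarrow> 'n one_form" and I :: "'n set"
  assumes A: "inner_product_on_Rn A" and Q: "psd_form Q" and "0 < c"
  defines "\<beta> \<equiv> \<lambda>y. \<chi> i. if i \<in> I then blinfun_apply (b i) y else 0"
  shows "deformation I b (\<lambda>s. sqrt (c + Q s s)) (\<lambda>y. sqrt (A y y))
       = (\<lambda>y. sqrt (c * A y y + Q (\<beta> y) (\<beta> y)))"
proof
  fix y
  have bil: "bilinear A" "bilinear Q" and nn: "\<And>s. 0 \<le> Q s s" and pos: "\<And>u. u \<noteq> 0 \<Longrightarrow> 0 < A u u"
    using A Q by (auto simp: psd_form_def inner_product_on_Rn_def)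
  define a where "a = sqrt (A y y)"
  have \<beta>: "(\<chi> i. if i \<in> I then blinfun_apply (b i) y / a else 0) = inverse a *\<^sub>R \<beta> y"
    by (simp add: vec_eq_iff \<beta>_def divide_inverse_commute)
  have "a * sqrt (c + Q (inverse a *\<^sub>R \<beta> y) (inverse a *\<^sub>R \<beta> y)) = sqrt (c * A y y + Q (\<beta> y) (\<beta> y))"
  proof (cases "y = 0")
    case True
    have "\<beta> y = 0" unfolding True \<beta>_def by (simp add: vec_eq_iff blinfun.zero_right)
    with True show ?thesis by (simp add: a_def bilinear_lzero bil)
  next
    case False
    then have a: "a > 0" "a\<^sup>2 = A y y"
      using pos[of y] by (auto simp: a_def)
    have "a * sqrt (c + Q (inverse a *\<^sub>R \<beta> y) (inverse a *\<^sub>R \<beta> y))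
        = sqrt (a\<^sup>2 * (c + Q (inverse a *\<^sub>R \<beta> y) (inverse a *\<^sub>R \<beta> y)))"
      using a(1) by (simp add: real_sqrt_mult)
    also have "a\<^sup>2 * (c + Q (inverse a *\<^sub>R \<beta> y) (inverse a *\<^sub>R \<beta> y)) = c * A y y + Q (\<beta> y) (\<beta> y)"
      using a(1) unfolding a(2)[symmetric]
      by (simp add: bilinear_lmul bilinear_rmul bil field_simps power2_eq_square)
    finally show ?thesis .
  qed
  then show "deformation I b (\<lambda>s. sqrt (c + Q s s)) (\<lambda>y. sqrt (A y y)) y
       = sqrt (c * A y y + Q (\<beta> y) (\<beta> y))"
    unfolding deformation_def a_def[symmetric] \<beta> .
qed

section \<open>Chains of deformations by a single form\<close>

lemma deformation_related_refl: "minkowski_norm F \<Longrightarrow> deformation_related p F F"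
  unfolding deformation_related_def by (intro exI[of _ 0] exI[of _ "\<lambda>_. F"]) auto

lemma deformation_related_step:
  assumes "deformation_related p F' F" "minkowski_norm (deformation I b \<phi> F')"
    "card I \<le> p" "admissible_deformation I b \<delta> \<phi> F'"
  shows "deformation_related p (deformation I b \<phi> F') F"
proof -
  obtain m :: nat and G where G: "\<forall>i\<le>m. minkowski_norm (G i)" "G 0 = F" "G m = F'"
    "\<forall>i\<in>{1..m}. \<exists>I b \<delta> \<phi>. card I \<le> p \<and>
       admissible_deformation I b \<delta> \<phi> (G (i - 1)) \<and> G i = deformation I b \<phi> (G (i - 1))"
    using assms(1) unfolding deformation_related_def by blast
  let ?G = "G(Suc m := deformation I b \<phi> F')"
  have "\<exists>I b \<delta> \<phi>. card I \<le> p \<and>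
       admissible_deformation I b \<delta> \<phi> (?G (i - 1)) \<and> ?G i = deformation I b \<phi> (?G (i - 1))"
    if "i \<in> {1..Suc m}" for i
  proof (cases "i = Suc m")
    case True
    then have "?G (i - 1) = F'" "?G i = deformation I b \<phi> F'" using G(3) by auto
    then show ?thesis using assms(3,4) by metis
  next
    case False
    with that have "?G (i - 1) = G (i - 1)" "?G i = G i" "i \<in> {1..m}" by auto
    then show ?thesis using G(4) by metis
  qed
  moreover have "minkowski_norm (?G i)" if "i \<le> Suc m" for i
    using that G(1) assms(2) by (auto simp: le_Suc_eq)
  ultimately show ?thesis
    unfolding deformation_related_def using G(2)
    by (intro exI[of _ "Suc m"] exI[of _ ?G]) auto
qed

text \<open>The deformation by \<open>\<phi> s = sqrt (c + \<mu> * s\<^sup>2)\<close>, where the only form \<open>\<beta>\<close> sits at an arbitrary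
  index \<open>k\<close>.  The case \<open>\<mu> = 0\<close> is a rescaling.\<close>
lemma deformation_related_add_square:
  fixes A :: "real ^ 'n \<Rightarrow> real ^ 'n \<Rightarrow> real"
  assumes rel: "deformation_related 1 (\<lambda>y. sqrt (A y y)) F" and A: "inner_product_on_Rn A"
    and "0 < c" "0 \<le> \<mu>" "\<beta> \<noteq> (0 :: 'n one_form)"
  shows "deformation_related 1 (\<lambda>y. sqrt (c * A y y + \<mu> * (blinfun_apply \<beta> y)\<^sup>2)) F"
proof -
  fix k :: 'n
  define Q where "Q = (\<lambda>s t :: real ^ 'n. (sqrt \<mu> * s $ k) * (sqrt \<mu> * t $ k))"
  have Q: "psd_form Q"
    unfolding Q_def by (rule psd_form_square) (auto simp: linear_iff algebra_simps)
  have "psd_form (\<lambda>x y. (sqrt \<mu> * blinfun_apply \<beta> x) * (sqrt \<mu> * blinfun_apply \<beta> y))"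
    by (rule psd_form_square) (auto simp: linear_iff algebra_simps blinfun.bilinear_simps)
  then have "inner_product_on_Rn (\<lambda>x y. c * A x y +
      (sqrt \<mu> * blinfun_apply \<beta> x) * (sqrt \<mu> * blinfun_apply \<beta> y))"
    by (rule inner_product_add_psd_form[OF A _ \<open>0 < c\<close>])
  moreover have eq: "(sqrt \<mu> * x) * (sqrt \<mu> * x) = \<mu> * x\<^sup>2" for x
    using \<open>0 \<le> \<mu>\<close> by (simp add: power2_eq_square algebra_simps)
  ultimately have "minkowski_norm (\<lambda>y. sqrt (c * A y y + \<mu> * (blinfun_apply \<beta> y)\<^sup>2))"
    using minkowski_norm_inner_product by fastforce
  moreover have "deformation {k} (\<lambda>_. \<beta>) (\<lambda>s. sqrt (c + Q s s)) (\<lambda>y. sqrt (A y y))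
      = (\<lambda>y. sqrt (c * A y y + \<mu> * (blinfun_apply \<beta> y)\<^sup>2))"
    by (subst euclidean_deformation[OF A Q \<open>0 < c\<close>]) (simp add: Q_def eq)
  moreover have "admissible_deformation {k} (\<lambda>_. \<beta>)
      (\<lambda>i. \<bar>form_norm (\<lambda>y. sqrt (A y y)) \<beta>\<bar> + 1) (\<lambda>s. sqrt (c + Q s s)) (\<lambda>y. sqrt (A y y))"
    using \<open>\<beta> \<noteq> 0\<close> by (intro admissible_sqrt_quadratic Q \<open>0 < c\<close>) auto
  ultimately show ?thesis
    using deformation_related_step[OF rel, of "{k}" "\<lambda>_. \<beta>" "\<lambda>s. sqrt (c + Q s s)"] by simp
qed

text \<open>One Cholesky step per coordinate in \<open>S\<close>: with \<open>e = axis k 1\<close> and \<open>Q e e > 0\<close>, split off the square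
  \<open>(Q e y)\<^sup>2 / Q e e\<close>.  The remainder is positive semidefinite by Cauchy-Schwarz, and \<open>e\<close> has joined
  its radical.  If \<open>Q e e = 0\<close>, Cauchy-Schwarz puts \<open>e\<close> in the radical of \<open>Q\<close> itself.\<close>
lemma deformation_related_add_psd_form:
  fixes A Q :: "real ^ 'n \<Rightarrow> real ^ 'n \<Rightarrow> real"
  assumes "finite S" "inner_product_on_Rn A" "psd_form Q" "\<And>i y. i \<notin> S \<Longrightarrow> Q (axis i 1) y = 0"
    and "deformation_related 1 (\<lambda>y. sqrt (A y y)) F"
  shows "deformation_related 1 (\<lambda>y. sqrt (A y y + Q y y)) F"
  using assms
proof (induction S arbitrary: A Q rule: finite_induct)
  case empty
  then have "Q y y = 0" for y
    by (subst bilinear_expand_left) (auto simp: psd_form_def)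
  then show ?case using empty by simp
next
  case (insert k S)
  have bil: "bilinear Q" and sym: "\<And>u v. Q u v = Q v u" and nn: "\<And>u. 0 \<le> Q u u"
    using insert.prems(2) by (auto simp: psd_form_def)
  let ?e = "axis k 1 :: real ^ 'n"
  note cs = psd_form_Cauchy_Schwarz[OF insert.prems(2)]
  show ?case
  proof (cases "Q ?e ?e = 0")
    case True
    then have "Q ?e y = 0" for y
      using cs[of ?e y] by simp
    then have "Q (axis i 1) y = 0" if "i \<notin> S" for i y
      using insert.prems(3) that by (cases "i = k") auto
    then show ?thesis
      by (intro insert.IH[of A Q] insert.prems(1,2,4))
  next
    case False
    then have pos: "0 < Q ?e ?e" using nn[of ?e] by simp
    define \<beta> where "\<beta> = Blinfun (Q ?e)"
    have \<beta>: "blinfun_apply \<beta> = Q ?e"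
      unfolding \<beta>_def using bil
      by (intro bounded_linear_Blinfun_apply) (simp add: bilinear_def linear_conv_bounded_linear)
    have "\<beta> \<noteq> 0" using False \<beta> by (metis zero_blinfun.rep_eq)
    define \<mu> where "\<mu> = 1 / Q ?e ?e"
    define A1 where "A1 = (\<lambda>x y. 1 * A x y + (sqrt \<mu> * Q ?e x) * (sqrt \<mu> * Q ?e y))"
    define Q1 where "Q1 = (\<lambda>x y. Q x y - \<mu> * (Q ?e x * Q ?e y))"
    have lin: "linear (Q ?e)" using bil by (simp add: bilinear_def)
    have "\<mu> > 0" using pos by (simp add: \<mu>_def)
    then have A1_eq: "A1 x y = A x y + \<mu> * (Q ?e x * Q ?e y)" for x y
      by (simp add: A1_def algebra_simps)
    have "inner_product_on_Rn A1"
      unfolding A1_def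
      by (intro inner_product_add_psd_form psd_form_square insert.prems)
         (use lin in \<open>auto simp: linear_iff algebra_simps\<close>)
    moreover have "psd_form Q1"
      unfolding psd_form_def
    proof (intro conjI allI)
      show "bilinear Q1"
        using bil lin unfolding Q1_def bilinear_def by (auto simp: linear_iff algebra_simps)
      show "Q1 u v = Q1 v u" for u v using sym[of u v] by (simp add: Q1_def)
      show "0 \<le> Q1 u u" for u
        using cs[of ?e u] pos by (simp add: Q1_def \<mu>_def field_simps power2_eq_square)
    qed
    moreover have "Q1 (axis i 1) y = 0" if "i \<notin> S" for i y
    proof (cases "i = k")
      case True
      then show ?thesis using pos by (simp add: Q1_def \<mu>_def)
    next
      case False
      then show ?thesis using that insert.prems(3)[of i] sym[of ?e "axis i 1"] by (simp add: Q1_def)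
    qed
    moreover have "deformation_related 1 (\<lambda>y. sqrt (A1 y y)) F"
      using deformation_related_add_square[OF insert.prems(4,1) zero_less_one less_imp_le[OF \<open>\<mu> > 0\<close>] \<open>\<beta> \<noteq> 0\<close>]
      by (simp add: A1_eq \<beta> power2_eq_square)
    ultimately have "deformation_related 1 (\<lambda>y. sqrt (A1 y y + Q1 y y)) F"
      by (rule insert.IH)
    then show ?thesis by (simp add: A1_eq Q1_def)
  qed
qed

section \<open>Coordinate forms and the comparison of two Euclidean norms\<close>

definition coordinate_form :: "'n::finite \<Rightarrow> 'n one_form" where
  "coordinate_form i = blinfun_inner_left (axis i 1)"

lemma coordinate_form_apply [simp]: "blinfun_apply (coordinate_form i) y = y $ i"
  by (simp add: coordinate_form_def inner_axis)

lemma inj_coordinate_form: "inj (coordinate_form :: 'n::finite \<Rightarrow> 'n one_form)"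
proof (rule injI)
  fix i j :: 'n
  assume "coordinate_form i = coordinate_form j"
  then have "(axis i 1 :: real ^ 'n) $ i = axis i 1 $ j"
    by (metis coordinate_form_apply)
  then show "i = j" by (simp add: axis_def split: if_splits)
qed

lemma independent_coordinate_forms: "independent (range (coordinate_form :: 'n::finite \<Rightarrow> 'n one_form))"
proof -
  have lin: "linear (blinfun_inner_left :: real ^ 'n \<Rightarrow> _)"
    by (rule bounded_linear.linear) (rule bounded_linear_blinfun_inner_left)
  have inj: "inj (blinfun_inner_left :: real ^ 'n \<Rightarrow> _)"
    by (rule injI) (metis blinfun_inner_left.rep_eq vector_eq_ldot)
  have "independent (range (\<lambda>i. axis i 1 :: real ^ 'n))"
    by (rule independent_mono[OF independent_Basis]) (auto simp: Basis_vec_def)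
  then have "independent (blinfun_inner_left ` range (\<lambda>i. axis i 1 :: real ^ 'n))"
    by (rule linear_independent_injective_image[OF lin]) (use inj in \<open>auto intro: inj_on_subset\<close>)
  moreover have "range coordinate_form = blinfun_inner_left ` range (\<lambda>i. axis i 1 :: real ^ 'n)"
    by (auto simp: coordinate_form_def)
  ultimately show ?thesis by simp
qed

theorem proposition8:
  fixes \<alpha> \<alpha>' :: "real ^ 'n \<Rightarrow> real"
  assumes "CARD('n) > 1"
    and "euclidean_norm \<alpha>"
    and "euclidean_norm \<alpha>'"
  shows "deformation_related 1 \<alpha>' \<alpha> \<and>
    (\<exists>I b \<delta> \<phi>. card I = CARD('n) \<and> admissible_deformation I b \<delta> \<phi> \<alpha> \<and>
       \<alpha>' = deformation I b \<phi> \<alpha>)"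
proof -
  obtain A where A: "inner_product_on_Rn A" and \<alpha>: "\<alpha> = (\<lambda>y. sqrt (A y y))"
    using assms(2) by (auto simp: euclidean_norm_def)
  obtain B where B: "inner_product_on_Rn B" and \<alpha>': "\<alpha>' = (\<lambda>y. sqrt (B y y))"
    using assms(3) by (auto simp: euclidean_norm_def)
  obtain c where c: "0 < c" "\<And>y. c * A y y \<le> B y y"
    using inner_product_dominates_multiple[OF A B] by blast
  define Q where "Q = (\<lambda>x y. B x y - c * A x y)"
  have Q: "psd_form Q"
    using A B c(2) unfolding psd_form_def inner_product_on_Rn_def bilinear_def Q_def
    by (auto simp: linear_iff algebra_simps)
  have "deformation_related 1 \<alpha>' \<alpha>"
  proof -
    fix k :: 'n
    \<comment> \<open>Rescaling by a constant \<open>\<phi>\<close> is still a deformation along some nonzero form; any one will do.\<close>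
    have "blinfun_apply (coordinate_form k) (axis k 1) \<noteq> 0" by (simp add: axis_def)
    then have "coordinate_form k \<noteq> 0" by (metis zero_blinfun.rep_eq)
    then have "deformation_related 1 (\<lambda>y. sqrt (c * A y y)) \<alpha>"
      using deformation_related_add_square[OF deformation_related_refl A c(1) order_refl]
        minkowski_norm_inner_product[OF A] by (fastforce simp: \<alpha>)
    moreover have "inner_product_on_Rn (\<lambda>x y. c * A x y)"
      using A c(1) by (auto simp: inner_product_on_Rn_def bilinear_def linear_iff algebra_simps)
    ultimately have "deformation_related 1 (\<lambda>y. sqrt (c * A y y + Q y y)) \<alpha>"
      using deformation_related_add_psd_form[of UNIV "\<lambda>x y. c * A x y" Q \<alpha>] Q by auto
    then show ?thesis by (simp add: \<alpha>' Q_def)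
  qed
  moreover have "\<alpha>' = deformation UNIV coordinate_form (\<lambda>s. sqrt (c + Q s s)) \<alpha>"
    unfolding \<alpha> \<alpha>' by (subst euclidean_deformation[OF A Q c(1)]) (simp add: Q_def)
  moreover have "admissible_deformation UNIV coordinate_form
      (\<lambda>i. \<bar>form_norm \<alpha> (coordinate_form i)\<bar> + 1) (\<lambda>s. sqrt (c + Q s s)) \<alpha>"
    by (intro admissible_sqrt_quadratic Q c inj_coordinate_form independent_coordinate_forms) simp
  ultimately show ?thesis by blast
qed

end
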